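(* There is an algorithm that, given an $n$-vertex graph $G$ and the value $vc^+(G)$, decides whether $G$ is well covered in time $O(1.4656^{vc^+(G)}\cdot n^2)$.
   Context: $vc^+(G)$ is the size of a maximum minimal vertex cover of $G$ (a vertex cover is a set of vertices meeting every edge; it is minimal if no proper subset is a vertex cover). $G$ is well covered if all minimal vertex covers of $G$ have the same size. *)

theory Defs
  imports Complex_Main
begin

definition simple_graph :: "'a set \<Rightarrow> 'a set set \<Rightarrow> bool" where
  "simple_graph V E \<longleftrightarrow> finite V \<and> (\<forall>e\<in>E. e \<subseteq> V \<and> card e = 2)"

definition vertex_cover :: "'a set \<Rightarrow> 'a set set \<Rightarrow> 'a set \<Rightarrow> bool" where
  "vertex_cover V E S \<longleftrightarrow> S \<subseteq> V \<and> (\<forall>e\<in>E. S \<inter> e \<noteq> {})"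

definition minimal_vertex_cover :: "'a set \<Rightarrow> 'a set set \<Rightarrow> 'a set \<Rightarrow> bool" where
  "minimal_vertex_cover V E S \<longleftrightarrow>
     vertex_cover V E S \<and> (\<forall>T. T \<subset> S \<longrightarrow> \<not> vertex_cover V E T)"

definition vc_plus :: "'a set \<Rightarrow> 'a set set \<Rightarrow> nat" where
  "vc_plus V E = Max {card S | S. minimal_vertex_cover V E S}"

definition well_covered :: "'a set \<Rightarrow> 'a set set \<Rightarrow> bool" where
  "well_covered V E \<longleftrightarrow>
     (\<forall>S T. minimal_vertex_cover V E S \<longrightarrow> minimal_vertex_cover V E T \<longrightarrow> card S = card T)"

text \<open>
  The model of computation is the unit-cost random access machine with addition and truncated
  subtraction: infinitely many registers holding natural numbers, indirect addressing, and a
  one-way read-only input. A configuration consists of the program counter, the registers and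
  the unread input.
\<close>

datatype instr =
    Read nat
  | Const nat nat
  | Copy nat nat
  | Add nat nat nat
  | Sub nat nat nat
  | Load nat nat
  | Store nat nat
  | Jump nat
  | JumpZero nat nat

type_synonym config = "nat \<times> (nat \<Rightarrow> nat) \<times> nat list"

fun exec_instr :: "instr \<Rightarrow> config \<Rightarrow> config" where
  "exec_instr (Read i) (pc, R, xs) =
     (Suc pc, R(i := (case xs of [] \<Rightarrow> 0 | x # _ \<Rightarrow> x)), tl xs)"
| "exec_instr (Const i c) (pc, R, xs) = (Suc pc, R(i := c), xs)"
| "exec_instr (Copy i j) (pc, R, xs) = (Suc pc, R(i := R j), xs)"
| "exec_instr (Add i j k) (pc, R, xs) = (Suc pc, R(i := R j + R k), xs)"
| "exec_instr (Sub i j k) (pc, R, xs) = (Suc pc, R(i := R j - R k), xs)"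
| "exec_instr (Load i j) (pc, R, xs) = (Suc pc, R(i := R (R j)), xs)"
| "exec_instr (Store i j) (pc, R, xs) = (Suc pc, R(R i := R j), xs)"
| "exec_instr (Jump l) (pc, R, xs) = (l, R, xs)"
| "exec_instr (JumpZero i l) (pc, R, xs) = (if R i = 0 then l else Suc pc, R, xs)"

text \<open>The machine halts when the program counter leaves the program.\<close>

definition halted :: "instr list \<Rightarrow> config \<Rightarrow> bool" where
  "halted P c \<longleftrightarrow> length P \<le> fst c"

definition step :: "instr list \<Rightarrow> config \<Rightarrow> config" where
  "step P c = (if halted P c then c else exec_instr (P ! fst c) c)"

definition initial :: "nat list \<Rightarrow> config" where
  "initial xs = (0, (\<lambda>_. 0), xs)"

text \<open>
  Halted configurations are fixed points of \<^const>\<open>step\<close>, so the following says that \<open>P\<close> halts on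
  input \<open>xs\<close> after at most \<open>t\<close> instructions. The output is read off register 0.
\<close>

definition computes_within :: "instr list \<Rightarrow> nat list \<Rightarrow> nat \<Rightarrow> nat \<Rightarrow> bool" where
  "computes_within P xs t out \<longleftrightarrow>
     (let c = (step P ^^ t) (initial xs) in halted P c \<and> fst (snd c) 0 = out)"

text \<open>
  The graph with vertices \<open>0, \<dots>, n - 1\<close> and edge set \<open>E\<close>, together with a number \<open>k\<close>, is
  presented as \<open>n\<close>, \<open>k\<close> and the rows of the adjacency matrix.
\<close>

definition encode :: "nat \<Rightarrow> nat set set \<Rightarrow> nat \<Rightarrow> nat list" where
  "encode n E k =
     n # k # concat (map (\<lambda>u. map (\<lambda>v. if {u, v} \<in> E then 1 else 0) [0..<n]) [0..<n])"

end

theory Submission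
  imports Defs
begin

text \<open>
  Every vertex cover contains a minimal one, so \<open>G\<close> is well covered iff it has no vertex cover with
  fewer than \<open>k = vc\<^sup>+(G)\<close> vertices. This is decided by branching: a vertex cover contains
  \<open>v\<close> or all of \<open>N(v)\<close>. If some \<open>v\<close> has degree 1, its neighbour may be taken without branching.
  Otherwise branch on \<open>v\<close> of maximum degree \<open>d\<close>. For \<open>d \<ge> 3\<close> the budget drops by 1 and by at least
  3, and \<open>x\<^sup>3 = x\<^sup>2 + 1\<close> has a root just below 1.4656. For \<open>d = 2\<close> deleting \<open>v\<close> leaves a
  neighbour of degree 1, so one more vertex is taken for free and the budget drops by 2 on both
  sides, which costs only \<open>\<surd>2\<close>. A search node takes \<open>O(n\<^sup>2)\<close> steps on the adjacency matrix.

  On the machine the pending search nodes form a stack of frames of \<open>n + 1\<close> cells: the bit vector of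
  the remaining vertices, followed by the strict bound \<open>c\<close> on the number of vertices still allowed.
  With strict bounds, truncated subtraction maps an overdrawn budget to 0, which marks a node
  without solution.
\<close>

section \<open>Structured programs\<close>

datatype com = Do "instr list" | Seq com com (infixr ";;" 60) | Ite nat com com | While nat com

type_synonym state = "(nat \<Rightarrow> nat) \<times> (nat \<Rightarrow> nat) \<times> nat list"

text \<open>
  Addresses below 32 are registers, the rest is memory reached only through \<^const>\<open>Load\<close> and
  \<^const>\<open>Store\<close>. Keeping the two apart in the state means that no aliasing between them
  has to be excluded when a program is executed symbolically.
\<close>

definition conc :: "nat \<Rightarrow> state \<Rightarrow> config" where
  "conc pc s = (pc, (\<lambda>a. if a < 32 then fst s a else fst (snd s) a), snd (snd s))"

text \<open>Jumps are excluded because control flow comes from \<open>com\<close> alone. The address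
  bounds are what makes \<open>effect\<close> agree with \<open>exec_instr\<close> under
  \<open>conc\<close>.\<close>

fun safe :: "instr \<Rightarrow> state \<Rightarrow> bool" where
  "safe (Read i) s = (i < 32)"
| "safe (Const i c) s = (i < 32)"
| "safe (Copy i j) s = (i < 32 \<and> j < 32)"
| "safe (Add i j k) s = (i < 32 \<and> j < 32 \<and> k < 32)"
| "safe (Sub i j k) s = (i < 32 \<and> j < 32 \<and> k < 32)"
| "safe (Load i j) s = (i < 32 \<and> j < 32 \<and> 32 \<le> fst s j)"
| "safe (Store i j) s = (i < 32 \<and> j < 32 \<and> 32 \<le> fst s i)"
| "safe (Jump l) s = False"
| "safe (JumpZero i l) s = False"

fun effect :: "instr \<Rightarrow> state \<Rightarrow> state" where
  "effect (Read i) (r, m, xs) = (r(i := (case xs of [] \<Rightarrow> 0 | x # _ \<Rightarrow> x)), m, tl xs)"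
| "effect (Const i c) (r, m, xs) = (r(i := c), m, xs)"
| "effect (Copy i j) (r, m, xs) = (r(i := r j), m, xs)"
| "effect (Add i j k) (r, m, xs) = (r(i := r j + r k), m, xs)"
| "effect (Sub i j k) (r, m, xs) = (r(i := r j - r k), m, xs)"
| "effect (Load i j) (r, m, xs) = (r(i := m (r j)), m, xs)"
| "effect (Store i j) (r, m, xs) = (r, m(r i := r j), xs)"
| "effect (Jump l) s = s"
| "effect (JumpZero i l) s = s"

text \<open>The postcondition style lets the simplifier execute a block symbolically and collect the
  safety conditions on the way.\<close>

fun runs :: "instr list \<Rightarrow> state \<Rightarrow> (state \<Rightarrow> bool) \<Rightarrow> bool" where
  "runs [] s Q = Q s"
| "runs (i # is) s Q = (safe i s \<and> runs is (effect i s) Q)"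

text \<open>The counter matches the compiled code: a nonzero branch or a loop round pays for the
  test and the closing jump, a zero branch only for the test.\<close>

inductive big :: "com \<Rightarrow> state \<Rightarrow> nat \<Rightarrow> state \<Rightarrow> bool" where
  Do: "runs is s (\<lambda>s'. s' = t) \<Longrightarrow> big (Do is) s (length is) t"
| Seq: "big a s k t \<Longrightarrow> big b t l u \<Longrightarrow> big (a ;; b) s (k + l) u"
| Ite1: "i < 32 \<Longrightarrow> fst s i \<noteq> 0 \<Longrightarrow> big a s k t \<Longrightarrow> big (Ite i a b) s (k + 2) t"
| Ite0: "i < 32 \<Longrightarrow> fst s i = 0 \<Longrightarrow> big b s k t \<Longrightarrow> big (Ite i a b) s (k + 1) t"
| While1: "i < 32 \<Longrightarrow> fst s i \<noteq> 0 \<Longrightarrow> big a s k t \<Longrightarrow> big (While i a) t l u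
    \<Longrightarrow> big (While i a) s (k + 2 + l) u"
| While0: "i < 32 \<Longrightarrow> fst s i = 0 \<Longrightarrow> big (While i a) s 1 s"

fun csize :: "com \<Rightarrow> nat" where
  "csize (Do is) = length is"
| "csize (a ;; b) = csize a + csize b"
| "csize (Ite i a b) = csize a + csize b + 2"
| "csize (While i a) = csize a + 2"

text \<open>Jump targets are absolute, hence the parameter \<open>p\<close>, the address of the
  first instruction.\<close>

fun compile :: "nat \<Rightarrow> com \<Rightarrow> instr list" where
  "compile p (Do is) = is"
| "compile p (a ;; b) = compile p a @ compile (p + csize a) b"
| "compile p (Ite i a b) = JumpZero i (p + csize a + 2) # compile (p + 1) a @
     Jump (p + csize a + csize b + 2) # compile (p + csize a + 2) b"
| "compile p (While i a) = JumpZero i (p + csize a + 2) # compile (p + 1) a @ [Jump p]"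

section \<open>Compiled code simulates the big-step semantics\<close>

lemma length_compile [simp]: "length (compile p c) = csize c"
  by (induction c arbitrary: p) auto

lemma exec_effect: "safe i s \<Longrightarrow> exec_instr i (conc pc s) = conc (Suc pc) (effect i s)"
  by (cases s; cases i) (auto simp: conc_def fun_eq_iff)

definition placed :: "instr list \<Rightarrow> nat \<Rightarrow> instr list \<Rightarrow> bool" where
  "placed P p is \<longleftrightarrow> p + length is \<le> length P \<and> (\<forall>j<length is. P ! (p + j) = is ! j)"

lemma placed_Cons: "placed P p (i # is) \<longleftrightarrow> p < length P \<and> P ! p = i \<and> placed P (Suc p) is"
  by (auto simp: placed_def less_Suc_eq_0_disj nth_Cons split: nat.splits)

lemma placed_append: "placed P p (is @ js) \<longleftrightarrow> placed P p is \<and> placed P (p + length is) js"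
proof (induction "is" arbitrary: p)
  case Nil
  then show ?case by (auto simp: placed_def)
qed (auto simp: placed_Cons)

lemma step_at: "p < length P \<Longrightarrow> step P (conc p s) = exec_instr (P ! p) (conc p s)"
  by (simp add: step_def halted_def conc_def)

lemma runs_steps:
  "runs is s (\<lambda>s'. s' = t) \<Longrightarrow> placed P p is \<Longrightarrow>
    (step P ^^ length is) (conc p s) = conc (p + length is) t"
proof (induction "is" arbitrary: s p)
  case (Cons i "is")
  then show ?case
    by (simp add: placed_Cons funpow_Suc_right step_at exec_effect del: funpow.simps)
qed simp

lemma funpow_trans: "(f ^^ k) x = y \<Longrightarrow> (f ^^ l) y = z \<Longrightarrow> (f ^^ (k + l)) x = z"
  by (metis add.commute comp_apply funpow_add)

lemma step_JumpZero:
  "p < length P \<Longrightarrow> P ! p = JumpZero i l \<Longrightarrow> i < 32 \<Longrightarrow>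
    (step P ^^ 1) (conc p s) = conc (if fst s i = 0 then l else Suc p) s"
  by (simp add: step_at) (simp add: conc_def)

lemma step_Jump:
  "p < length P \<Longrightarrow> P ! p = Jump l \<Longrightarrow> (step P ^^ 1) (conc p s) = conc l s"
  by (simp add: step_at) (simp add: conc_def)

text \<open>Induction on the derivation with \<open>p\<close> arbitrary. After a loop round the
  closing jump returns to \<open>p\<close>, so the remaining rounds use the same placement.\<close>

lemma big_steps:
  "big c s k t \<Longrightarrow> placed P p (compile p c) \<Longrightarrow> (step P ^^ k) (conc p s) = conc (p + csize c) t"
proof (induction arbitrary: p rule: big.induct)
  case (Do "is" s t)
  then show ?case by (simp add: runs_steps)
next
  case (Seq a s k t b l u)
  then have "placed P p (compile p a)" "placed P (p + csize a) (compile (p + csize a) b)"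
    by (auto simp: placed_append)
  then show ?case using funpow_trans[OF Seq.IH] by (simp add: add.assoc)
next
  case (Ite1 i s a k t b)
  then have *: "p < length P" "P ! p = JumpZero i (p + csize a + 2)" "placed P (Suc p) (compile (Suc p) a)"
    "Suc p + csize a < length P" "P ! (Suc p + csize a) = Jump (p + csize a + csize b + 2)"
    by (auto simp: placed_Cons placed_append)
  have "(step P ^^ (1 + (k + 1))) (conc p s) = conc (p + csize a + csize b + 2) t"
    using step_JumpZero[OF *(1,2), of s] Ite1(1,2) Ite1.IH[OF *(3)] step_Jump[OF *(4,5), of t]
    by (intro funpow_trans) auto
  then show ?case by (simp add: add_ac)
next
  case (Ite0 i s b k t a)
  then have *: "p < length P" "P ! p = JumpZero i (p + csize a + 2)"
    "placed P (p + csize a + 2) (compile (p + csize a + 2) b)"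
    by (auto simp: placed_Cons placed_append)
  have "(step P ^^ (1 + k)) (conc p s) = conc (p + csize a + 2 + csize b) t"
    using step_JumpZero[OF *(1,2), of s] Ite0(1,2) Ite0.IH[OF *(3)]
    by (intro funpow_trans) auto
  then show ?case by (simp add: add_ac)
next
  case (While1 i s a k t l u)
  then have *: "p < length P" "P ! p = JumpZero i (p + csize a + 2)" "placed P (Suc p) (compile (Suc p) a)"
    "Suc p + csize a < length P" "P ! (Suc p + csize a) = Jump p"
    by (auto simp: placed_Cons placed_append)
  have "(step P ^^ (1 + (k + (1 + l)))) (conc p s) = conc (p + csize (While i a)) u"
    using step_JumpZero[OF *(1,2), of s] While1(1,2) While1.IH(1)[OF *(3)]
      step_Jump[OF *(4,5), of t] While1.IH(2)[OF While1.prems]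
    by (intro funpow_trans) auto
  then show ?case by (simp add: add_ac)
next
  case (While0 i s a)
  then have *: "p < length P" "P ! p = JumpZero i (p + csize a + 2)"
    by (auto simp: placed_Cons placed_append)
  then show ?case using step_JumpZero[OF *, of s] While0 by simp
qed

text \<open>
  Charging \<open>n\<close> iterations to every loop makes the time bound a function of the program text, so that
  \<open>ht\<close> (total correctness within this bound) composes without any arithmetic on running times.
\<close>

fun cost :: "nat \<Rightarrow> com \<Rightarrow> nat" where
  "cost n (Do is) = length is"
| "cost n (a ;; b) = cost n a + cost n b"
| "cost n (Ite i a b) = cost n a + cost n b + 2"
| "cost n (While i a) = n * (cost n a + 2) + 1"

definition ht :: "nat \<Rightarrow> com \<Rightarrow> state \<Rightarrow> (state \<Rightarrow> bool) \<Rightarrow> bool" where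
  "ht n c s Q \<longleftrightarrow> (\<exists>k t. big c s k t \<and> k \<le> cost n c \<and> Q t)"

section \<open>Proof rules for timed total correctness\<close>

lemma runs_iff: "runs is s Q \<longleftrightarrow> (\<exists>t. runs is s (\<lambda>s'. s' = t) \<and> Q t)"
  by (induction "is" arbitrary: s) auto

lemma ht_Do: "runs is s Q \<Longrightarrow> ht n (Do is) s Q"
  using runs_iff[of "is" s Q] by (fastforce simp: ht_def intro: big.Do)

lemma ht_Seq:
  assumes "ht n a s (\<lambda>s'. ht n b s' Q)"
  shows "ht n (a ;; b) s Q"
proof -
  obtain k t l u where "big a s k t" "k \<le> cost n a" "big b t l u" "l \<le> cost n b" "Q u"
    using assms by (auto simp: ht_def)
  then have "big (a ;; b) s (k + l) u" "k + l \<le> cost n (a ;; b)" by (auto intro: big.Seq)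
  then show ?thesis using \<open>Q u\<close> unfolding ht_def by blast
qed

lemma ht_Ite:
  assumes "i < 32" "fst s i \<noteq> 0 \<Longrightarrow> ht n a s Q" "fst s i = 0 \<Longrightarrow> ht n b s Q"
  shows "ht n (Ite i a b) s Q"
proof (cases "fst s i = 0")
  case True
  then obtain k t where "big b s k t" "k \<le> cost n b" "Q t" using assms(3) by (auto simp: ht_def)
  moreover from this have "k + 1 \<le> cost n (Ite i a b)" by simp
  ultimately show ?thesis using Ite0[OF assms(1) True] unfolding ht_def by blast
next
  case False
  then obtain k t where "big a s k t" "k \<le> cost n a" "Q t" using assms(2) by (auto simp: ht_def)
  moreover from this have "k + 2 \<le> cost n (Ite i a b)" by simp
  ultimately show ?thesis using Ite1[OF assms(1) False] unfolding ht_def by blast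
qed

lemma ht_mono: "ht n c s Q \<Longrightarrow> (\<And>s'. Q s' \<Longrightarrow> Q' s') \<Longrightarrow> ht n c s Q'"
  unfolding ht_def by blast

text \<open>Induction on the number \<open>j\<close> of rounds still to come; the invariant is
  indexed by the number \<open>n - j\<close> of rounds already done.\<close>

lemma ht_For_aux:
  assumes "i < 32"
    and step: "\<And>k s. k < n \<Longrightarrow> I k s \<Longrightarrow> fst s i \<noteq> 0 \<and> ht n c s (I (Suc k))"
    and fin: "\<And>s. I n s \<Longrightarrow> fst s i = 0"
  shows "I (n - j) s \<Longrightarrow> j \<le> n \<Longrightarrow> \<exists>k t. big (While i c) s k t \<and> k \<le> j * (cost n c + 2) + 1 \<and> I n t"
proof (induction j arbitrary: s)
  case 0
  then have "fst s i = 0" "I n s" using fin by auto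
  then show ?case using While0[OF assms(1), of s c] by (intro exI[of _ 1] exI[of _ s]) auto
next
  case (Suc j)
  then have nz: "fst s i \<noteq> 0" and "ht n c s (I (n - j))"
    using step[of "n - Suc j" s] by (auto simp: Suc_diff_Suc)
  then obtain k t where kt: "big c s k t" "k \<le> cost n c" "I (n - j) t" by (auto simp: ht_def)
  then obtain l u where lu: "big (While i c) t l u" "l \<le> j * (cost n c + 2) + 1" "I n u"
    using Suc.IH[of t] Suc.prems by auto
  have "k + 2 + l \<le> Suc j * (cost n c + 2) + 1" using kt(2) lu(2) by simp
  then show ?case using big.While1[OF assms(1) nz kt(1) lu(1)] lu(3) by blast
qed

text \<open>The guard stays nonzero for exactly \<open>n\<close> rounds, which is what
  \<open>cost\<close> charges.\<close>

lemma ht_For: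
  assumes "i < 32" "I 0 s"
    and "\<And>k s. k < n \<Longrightarrow> I k s \<Longrightarrow> fst s i \<noteq> 0 \<and> ht n c s (I (Suc k))"
    and "\<And>s. I n s \<Longrightarrow> fst s i = 0"
    and "\<And>s. I n s \<Longrightarrow> Q s"
  shows "ht n (While i c) s Q"
proof -
  have "\<exists>k t. big (While i c) s k t \<and> k \<le> n * (cost n c + 2) + 1 \<and> I n t"
    by (rule ht_For_aux[where I = I]) (use assms in auto)
  then show ?thesis unfolding ht_def cost.simps using assms(5) by blast
qed

text \<open>For the search loop, whose number of rounds is not bounded by \<open>n\<close>: the
  index of the invariant is a potential that each round lowers by one. The time is therefore stated
  through \<open>big\<close> instead of \<open>ht\<close>.\<close>

lemma big_While:
  assumes "i < 32"
    and step: "\<And>k s. I k s \<Longrightarrow> fst s i \<noteq> 0 \<Longrightarrow> k \<noteq> 0 \<and> ht n c s (I (k - 1))"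
  shows "I j s \<Longrightarrow> \<exists>k t l. big (While i c) s k t \<and> k \<le> j * (cost n c + 2) + 1 \<and> I l t \<and> fst t i = 0"
proof (induction j arbitrary: s)
  case 0
  then have "fst s i = 0" using step by blast
  then show ?case using While0[OF assms(1), of s c] 0
    by (intro exI[of _ 1] exI[of _ s] exI[of _ 0]) auto
next
  case (Suc j)
  show ?case
  proof (cases "fst s i = 0")
    case True
    then show ?thesis using While0[OF assms(1), of s c] Suc.prems
      by (intro exI[of _ 1] exI[of _ s] exI[of _ "Suc j"]) auto
  next
    case False
    then obtain k t where kt: "big c s k t" "k \<le> cost n c" "I j t"
      using step[OF Suc.prems] by (auto simp: ht_def)
    then obtain l u p where lu: "big (While i c) t l u" "l \<le> j * (cost n c + 2) + 1"
      "I p u" "fst u i = 0"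
      using Suc.IH by blast
    have "k + 2 + l \<le> Suc j * (cost n c + 2) + 1" using kt(2) lu(2) by simp
    then show ?thesis using big.While1[OF assms(1) False kt(1) lu(1)] lu(3,4) by blast
  qed
qed

section \<open>Branching on a vertex\<close>

text \<open>Concerns the subgraph induced on \<open>A\<close>: edges leaving \<open>A\<close> are
  ignored, since deleted vertices count as already chosen. By strictness nothing is solvable for
  \<open>c = 0\<close>.\<close>

definition sol :: "'a set set \<Rightarrow> 'a set \<Rightarrow> nat \<Rightarrow> bool" where
  "sol E A c \<longleftrightarrow> (\<exists>S\<subseteq>A. (\<forall>e\<in>E. e \<subseteq> A \<longrightarrow> S \<inter> e \<noteq> {}) \<and> card S < c)"

definition nbrs :: "'a set set \<Rightarrow> 'a set \<Rightarrow> 'a \<Rightarrow> 'a set" where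
  "nbrs E A v = {u \<in> A. {v, u} \<in> E}"

definition has_leaf :: "'a set set \<Rightarrow> 'a set \<Rightarrow> bool" where
  "has_leaf E A \<longleftrightarrow> (\<exists>v\<in>A. card (nbrs E A v) = 1)"

lemma not_self_edge: "simple_graph V E \<Longrightarrow> {v, v} \<notin> E"
  by (auto simp: simple_graph_def)

lemma simple_graph_edgeE:
  assumes "simple_graph V E" "e \<in> E"
  obtains u v where "e = {u, v}" "u \<noteq> v"
  using assms by (auto simp: simple_graph_def card_2_iff)

lemma sol_edgeless:
  assumes "simple_graph V E" "\<forall>v\<in>A. nbrs E A v = {}" "c > 0"
  shows "sol E A c"
proof -
  have "\<not> e \<subseteq> A" if e: "e \<in> E" for e
  proof -
    obtain u v where "e = {u, v}" using simple_graph_edgeE[OF assms(1) e] by metis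
    then show ?thesis using assms(2) e by (auto simp: nbrs_def)
  qed
  then show ?thesis using assms(3) by (auto simp: sol_def intro!: exI[of _ "{}"])
qed

text \<open>A cover avoiding \<open>v\<close> must contain every neighbour of \<open>v\<close>. In
  the second branch \<open>v\<close> stays in the set as an isolated vertex, so that the new set is
  a plain difference with the matrix row of \<open>v\<close>.\<close>

lemma sol_branch:
  assumes G: "simple_graph V E" and A: "finite A" "v \<in> A"
  shows "sol E A c \<longleftrightarrow> sol E (A - {v}) (c - 1) \<or> sol E (A - nbrs E A v) (c - card (nbrs E A v))"
proof
  assume "sol E A c"
  then obtain S where S: "S \<subseteq> A" "\<forall>e\<in>E. e \<subseteq> A \<longrightarrow> S \<inter> e \<noteq> {}" "card S < c"
    by (auto simp: sol_def)
  have fS: "finite S" using S(1) A(1) finite_subset by blast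
  show "sol E (A - {v}) (c - 1) \<or> sol E (A - nbrs E A v) (c - card (nbrs E A v))"
  proof (cases "v \<in> S")
    case True
    have "sol E (A - {v}) (c - 1)"
      unfolding sol_def
    proof (intro exI[of _ "S - {v}"] conjI ballI impI)
      fix e assume "e \<in> E" "e \<subseteq> A - {v}"
      moreover from this have "S \<inter> e \<noteq> {}" using S(2) by blast
      ultimately show "(S - {v}) \<inter> e \<noteq> {}" by blast
    next
      show "card (S - {v}) < c - 1"
        using True fS S(3) card_Diff_singleton[OF True] card_gt_0_iff[of S] by auto
    qed (use S in auto)
    then show ?thesis ..
  next
    case False
    have N: "nbrs E A v \<subseteq> S"
      using S(2) A(2) False by (fastforce simp: nbrs_def)
    have "sol E (A - nbrs E A v) (c - card (nbrs E A v))"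
      unfolding sol_def
    proof (intro exI[of _ "S - nbrs E A v"] conjI ballI impI)
      fix e assume "e \<in> E" "e \<subseteq> A - nbrs E A v"
      moreover from this have "S \<inter> e \<noteq> {}" using S(2) by blast
      ultimately show "(S - nbrs E A v) \<inter> e \<noteq> {}" by blast
    next
      show "card (S - nbrs E A v) < c - card (nbrs E A v)"
        using N fS S(3) card_mono[OF fS N] by (simp add: card_Diff_subset finite_subset)
    qed (use S in auto)
    then show ?thesis ..
  qed
next
  assume "sol E (A - {v}) (c - 1) \<or> sol E (A - nbrs E A v) (c - card (nbrs E A v))"
  then show "sol E A c"
  proof
    assume "sol E (A - {v}) (c - 1)"
    then obtain S where S: "S \<subseteq> A - {v}" "\<forall>e\<in>E. e \<subseteq> A - {v} \<longrightarrow> S \<inter> e \<noteq> {}" "card S < c - 1"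
      by (auto simp: sol_def)
    show ?thesis
      unfolding sol_def
    proof (intro exI[of _ "insert v S"] conjI ballI impI)
      fix e assume "e \<in> E" "e \<subseteq> A"
      then show "insert v S \<inter> e \<noteq> {}" using S(2) by (cases "v \<in> e") auto
    next
      show "card (insert v S) < c"
        using S(3) card_insert_le_m1[of "card S + 1" S v] by simp
    qed (use S A in auto)
  next
    assume "sol E (A - nbrs E A v) (c - card (nbrs E A v))"
    then obtain S where S: "S \<subseteq> A - nbrs E A v"
      "\<forall>e\<in>E. e \<subseteq> A - nbrs E A v \<longrightarrow> S \<inter> e \<noteq> {}" "card S < c - card (nbrs E A v)"
      by (auto simp: sol_def)
    show ?thesis
      unfolding sol_def
    proof (intro exI[of _ "S \<union> nbrs E A v"] conjI ballI impI)
      fix e assume "e \<in> E" "e \<subseteq> A"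
      then show "(S \<union> nbrs E A v) \<inter> e \<noteq> {}" using S(2) by (cases "e \<inter> nbrs E A v = {}") auto
    next
      show "card (S \<union> nbrs E A v) < c"
        using S(3) card_Un_le[of S "nbrs E A v"] by linarith
      show "S \<union> nbrs E A v \<subseteq> A" using S(1) by (auto simp: nbrs_def)
    qed
  qed
qed

text \<open>A cover contains \<open>v\<close> or its only neighbour \<open>w\<close>. Dropping both
  saves at least one vertex, and the rest still covers the graph without \<open>w\<close>, where no
  edge meets \<open>v\<close>.\<close>

lemma sol_leaf:
  assumes G: "simple_graph V E" and A: "finite A" "v \<in> A" and N: "card (nbrs E A v) = 1"
  shows "sol E A c \<longleftrightarrow> sol E (A - nbrs E A v) (c - 1)"
proof
  assume "sol E (A - nbrs E A v) (c - 1)"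
  then show "sol E A c" using sol_branch[OF G A, of c] N by simp
next
  assume "sol E A c"
  then obtain S where S: "S \<subseteq> A" "\<forall>e\<in>E. e \<subseteq> A \<longrightarrow> S \<inter> e \<noteq> {}" "card S < c"
    by (auto simp: sol_def)
  have fS: "finite S" using S(1) A(1) finite_subset by blast
  obtain w where w: "nbrs E A v = {w}" using N by (auto simp: card_1_singleton_iff)
  then have vw: "w \<in> A" "{v, w} \<in> E" by (auto simp: nbrs_def)
  then have vwS: "S \<inter> {v, w} \<noteq> {}" using S(2)[rule_format, OF vw(2)] A(2) by simp
  show "sol E (A - nbrs E A v) (c - 1)"
    unfolding sol_def w
  proof (intro exI[of _ "S - {v, w}"] conjI ballI impI)
    fix e assume e: "e \<in> E" "e \<subseteq> A - {w}"
    have "v \<notin> e"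
    proof
      assume "v \<in> e"
      obtain x y where "e = {x, y}" "x \<noteq> y" using simple_graph_edgeE[OF G e(1)] by metis
      then obtain z where "e = {v, z}" using \<open>v \<in> e\<close> by auto
      then have "z \<in> nbrs E A v" using e by (auto simp: nbrs_def)
      then show False using w e \<open>e = {v, z}\<close> by auto
    qed
    moreover have "S \<inter> e \<noteq> {}" using S(2) e by blast
    ultimately show "(S - {v, w}) \<inter> e \<noteq> {}" using e by blast
  next
    have "S - {v, w} \<subset> S" using vwS by blast
    then have "card (S - {v, w}) < card S" using fS psubset_card_mono by blast
    then show "card (S - {v, w}) < c - 1" using S(3) by linarith
  qed (use S in auto)
qed

section \<open>Well-coveredness as a question about small covers\<close>

lemma minimal_vertex_cover_exists:
  assumes "vertex_cover V E S" "finite S"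
  shows "\<exists>T\<subseteq>S. minimal_vertex_cover V E T"
  using assms(2,1)
proof (induction S rule: finite_psubset_induct)
  case (psubset S)
  show ?case
  proof (cases "minimal_vertex_cover V E S")
    case False
    then obtain T where "T \<subset> S" "vertex_cover V E T"
      using psubset.prems by (auto simp: minimal_vertex_cover_def)
    then show ?thesis using psubset.IH by (meson order.trans psubset_imp_subset)
  qed auto
qed

text \<open>A cover below the maximum shrinks to a minimal one of a different size than the largest.
  Conversely, if no cover is below the maximum, every minimal cover attains it.\<close>

lemma well_covered_iff_not_sol:
  assumes G: "simple_graph V E"
  shows "well_covered V E \<longleftrightarrow> \<not> sol E V (vc_plus V E)"
proof -
  let ?M = "{card S | S. minimal_vertex_cover V E S}"
  have fV: "finite V" and EV: "\<And>e. e \<in> E \<Longrightarrow> e \<subseteq> V" using G by (auto simp: simple_graph_def)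
  \<comment> \<open>Provides a minimal cover, so that the \<open>Max\<close> in
    \<open>vc_plus\<close> ranges over a nonempty set.\<close>
  have "vertex_cover V E V"
    using G by (auto simp: vertex_cover_def simple_graph_def Int_absorb1)
  then obtain M where M: "minimal_vertex_cover V E M"
    using minimal_vertex_cover_exists fV by blast
  have fM: "finite ?M"
    by (rule finite_subset[of _ "card ` Pow V"])
      (auto simp: fV minimal_vertex_cover_def vertex_cover_def)
  have "vc_plus V E \<in> ?M" unfolding vc_plus_def using M by (intro Max_in fM) blast
  then obtain T where T: "minimal_vertex_cover V E T" "card T = vc_plus V E" by auto
  have le: "card S \<le> vc_plus V E" if "minimal_vertex_cover V E S" for S
    unfolding vc_plus_def using that by (intro Max_ge fM) blast
  show ?thesis
  proof
    assume W: "well_covered V E"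
    show "\<not> sol E V (vc_plus V E)"
    proof
      assume "sol E V (vc_plus V E)"
      then obtain S where S: "vertex_cover V E S" "card S < vc_plus V E"
        using EV by (auto simp: sol_def vertex_cover_def)
      then have fS: "finite S" using fV finite_subset by (auto simp: vertex_cover_def)
      obtain U where U: "U \<subseteq> S" "minimal_vertex_cover V E U"
        using minimal_vertex_cover_exists[OF S(1) fS] by blast
      then have "card U < card T" using S(2) T(2) card_mono[OF fS U(1)] by simp
      then show False using W[unfolded well_covered_def, rule_format, OF U(2) T(1)] by simp
    qed
  next
    assume N: "\<not> sol E V (vc_plus V E)"
    have "card S = vc_plus V E" if S: "minimal_vertex_cover V E S" for S
    proof -
      have "S \<subseteq> V" "\<forall>e\<in>E. S \<inter> e \<noteq> {}"
        using S by (auto simp: minimal_vertex_cover_def vertex_cover_def)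
      then have "sol E V (vc_plus V E)" if "card S < vc_plus V E"
        unfolding sol_def using that by (intro exI[of _ S]) auto
      then show ?thesis using le[OF S] N by linarith
    qed
    then show "well_covered V E" by (simp add: well_covered_def)
  qed
qed

section \<open>The size of the branching tree\<close>

definition phi :: real where
  "phi = 1.4656"

text \<open>The quadratic inequality serves branching at degree 2, the cubic one branching at degree
  at least 3.\<close>

lemma phi_bounds: "1465/1000 \<le> phi" "phi \<le> 1466/1000" "2 \<le> phi ^ 2" "1 + phi ^ 2 \<le> phi ^ 3"
  by (simp_all add: phi_def power2_eq_square power3_eq_cube)

lemma phi_power_ge_1: "1 \<le> phi ^ c"
  using phi_bounds by (intro one_le_power) simp

text \<open>The offset 2 pays for the branching node and, at degree 2, also for the leaf step that
  follows. The factor 4 leaves room for \<open>c = 1\<close> and \<open>c = 2\<close>, where the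
  budget of a child may be cut off at 0.\<close>

definition tree_bound :: "nat \<Rightarrow> real" where
  "tree_bound c = 4 * phi ^ c - 2"

text \<open>Bounds the number of search nodes below \<open>(A, c)\<close>. A leaf earns a discount,
  because the next step lowers the budget without branching.\<close>

definition weight :: "'a set set \<Rightarrow> 'a set \<Rightarrow> nat \<Rightarrow> real" where
  "weight E A c = (if c = 0 then 1 else if has_leaf E A then 1 + tree_bound (c - 1) else tree_bound c)"

lemma tree_bound_mono: "c \<le> d \<Longrightarrow> tree_bound c \<le> tree_bound d"
  using phi_bounds by (simp add: tree_bound_def)

lemma tree_bound_Suc: "1 + tree_bound c \<le> tree_bound (Suc c)"
proof -
  have "(1465/1000) * phi ^ c \<le> phi * phi ^ c"
    using phi_bounds phi_power_ge_1[of c] by (intro mult_right_mono) auto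
  then show ?thesis using phi_power_ge_1[of c] unfolding tree_bound_def power_Suc by linarith
qed

lemma weight_le: "weight E A c \<le> tree_bound c"
  using tree_bound_Suc[of "c - 1"] by (cases c) (auto simp: weight_def tree_bound_def)

lemma weight_ge_1: "1 \<le> weight E A c"
proof (cases c)
  case (Suc j)
  have "1 \<le> 1 + tree_bound j" using phi_power_ge_1[of j] by (simp add: tree_bound_def)
  then show ?thesis using tree_bound_Suc[of j] Suc by (simp add: weight_def)
qed (simp add: weight_def)

lemma weight_leaf:
  assumes "has_leaf E A" "c > 0"
  shows "1 + weight E B (c - 1) \<le> weight E A c"
  using assms weight_le[of E B "c - 1"] by (simp add: weight_def)

text \<open>Pays for the node and both children. \<open>B\<close> is arbitrary, as only the first
  child is ever credited with a leaf.\<close>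

lemma weight_branch:
  assumes G: "simple_graph V E" and A: "finite A" "v \<in> A" and c: "c > 0"
    and no: "\<not> has_leaf E A" and d: "card (nbrs E A v) \<ge> 2"
    and mx: "\<And>u. u \<in> A \<Longrightarrow> card (nbrs E A u) \<le> card (nbrs E A v)"
  shows "1 + weight E (A - {v}) (c - 1) + weight E B (c - card (nbrs E A v)) \<le> weight E A c"
proof -
  let ?d = "card (nbrs E A v)"
  have WA: "weight E A c = tree_bound c" using c no by (simp add: weight_def)
  consider "c = 1" | "c \<ge> 2" "?d = 2" | "c = 2" "?d \<ge> 3" | "c \<ge> 3" "?d \<ge> 3"
    using c d by linarith
  then show ?thesis
  proof cases
    case 1
    then show ?thesis unfolding WA using d phi_bounds by (simp add: weight_def tree_bound_def)
  next
    case 2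
    \<comment> \<open>All degrees are at most 2 and none is 1, so a neighbour \<open>u\<close> of
      \<open>v\<close> has degree exactly 2 and becomes a leaf once \<open>v\<close> is
      deleted.\<close>
    then obtain u where u: "u \<in> nbrs E A v" by fastforce
    then have uA: "u \<in> A" "{v, u} \<in> E" "u \<noteq> v" using not_self_edge[OF G] by (auto simp: nbrs_def)
    have vu: "v \<in> nbrs E A u" using uA A by (auto simp: nbrs_def insert_commute)
    have fin: "finite (nbrs E A u)" using A(1) by (auto simp: nbrs_def)
    then have "card (nbrs E A u) \<noteq> 0" using vu by auto
    moreover have "card (nbrs E A u) \<noteq> 1" using no uA by (auto simp: has_leaf_def)
    ultimately have "card (nbrs E A u) = 2" using mx[OF uA(1)] 2(2) by linarith
    moreover have "nbrs E (A - {v}) u = nbrs E A u - {v}" by (auto simp: nbrs_def)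
    ultimately have "card (nbrs E (A - {v}) u) = 1" using vu fin by simp
    then have leaf: "has_leaf E (A - {v})" using uA by (auto simp: has_leaf_def)
    then have "weight E (A - {v}) (c - 1) = 1 + tree_bound (c - 2)"
      using 2(1) by (simp add: weight_def numeral_2_eq_2)
    moreover obtain j where j: "c = j + 2" using 2(1) by (metis le_Suc_ex add.commute)
    \<comment> \<open>The summand 2 counts this node and the leaf step in the first child;
      afterwards both sides have budget \<open>c - 2\<close>.\<close>
    moreover have "2 + 2 * tree_bound j \<le> tree_bound (j + 2)"
    proof -
      have "2 * phi ^ j \<le> phi ^ 2 * phi ^ j"
        using phi_bounds phi_power_ge_1[of j] by (intro mult_right_mono) auto
      then show ?thesis unfolding tree_bound_def power_add mult.commute[of _ "phi ^ 2"]
        by (simp add: right_diff_distrib mult.commute del: mult_le_cancel_right mult_le_cancel_left)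
    qed
    ultimately show ?thesis using WA 2(2) weight_le[of E B "c - 2"] by simp
  next
    case 3
    \<comment> \<open>The second child has budget 0 by truncation and weighs 1.\<close>
    then show ?thesis unfolding WA using weight_le[of E "A - {v}" 1] phi_bounds
      by (simp add: weight_def[of _ B] tree_bound_def)
  next
    case 4
    then obtain j where j: "c = j + 3" by (metis le_Suc_ex add.commute)
    have "weight E B (c - ?d) \<le> tree_bound j"
      using 4 j by (intro order.trans[OF weight_le tree_bound_mono]) simp
    moreover have "weight E (A - {v}) (c - 1) \<le> tree_bound (j + 2)"
      using weight_le[of E "A - {v}" "c - 1"] j by simp
    moreover have "1 + tree_bound (j + 2) + tree_bound j \<le> tree_bound (j + 3)"
    proof -
      have "(1 + phi ^ 2) * phi ^ j \<le> phi ^ 3 * phi ^ j"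
        using phi_bounds phi_power_ge_1[of j] by (intro mult_right_mono) auto
      moreover have e: "phi ^ (j + 2) = phi ^ 2 * phi ^ j" "phi ^ (j + 3) = phi ^ 3 * phi ^ j"
        by (simp_all only: power_add mult.commute)
      ultimately have "phi ^ j + phi ^ (j + 2) \<le> phi ^ (j + 3)"
        unfolding e by (simp only: distrib_right mult_1)
      then show ?thesis unfolding tree_bound_def by linarith
    qed
    ultimately show ?thesis using WA j by simp
  qed
qed

section \<open>The program\<close>

text \<open>
  Register 0 holds the output, 2 and 6 the constants 1 and 2, 26 and 3 the numbers \<open>n\<close> and \<open>n + 1\<close>,
  4 the first free address above the stack, 5 the number of frames, 7 and 8 the base address and
  the bound of the current frame. Memory holds the matrix row by row from address 32 on, and the
  stack right above it.

  The scan computes in register 17 the degree of each vertex \<open>u\<close>; the conjunction of three bits is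
  their sum minus 2, truncated. It ranks vertices by a key (18; the best is in 19) that puts
  degree 1 first and is otherwise the degree. For the best vertex, 20 is its degree, 22 the address
  of its matrix row, and 21 the address of its bit in the frame above the current one.
\<close>

definition degree_loop :: com where
  "degree_loop = While 13 (Do [Load 15 12, Load 16 9, Add 15 15 16, Add 15 15 14, Sub 15 15 6,
     Add 17 17 15, Add 12 12 2, Add 9 9 2, Sub 13 13 2])"

text \<open>With truncated subtraction, \<open>(2 - d) - 2 * (1 - d)\<close> is 1 for degree
  \<open>d = 1\<close> and 0 for every other \<open>d\<close>; it serves as the test for a
  leaf.\<close>

definition update_best :: com where
  "update_best = Do [Copy 18 17, Sub 15 6 17, Sub 16 2 17, Sub 15 15 16, Sub 15 15 16] ;;
     Ite 15 (Do [Add 18 18 26]) (Do []) ;;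
     Do [Sub 15 18 19] ;;
     Ite 15 (Do [Copy 19 18, Copy 20 17, Copy 22 23, Add 21 10 3]) (Do [])"

definition scan_body :: com where
  "scan_body = Do [Load 14 10, Copy 23 9, Copy 12 7, Const 17 0, Copy 13 26] ;; degree_loop ;;
     update_best ;; Do [Add 10 10 2, Sub 11 11 2]"

definition scan :: com where
  "scan = Do [Const 9 32, Copy 10 7, Copy 11 26, Const 19 0] ;; While 11 scan_body"

text \<open>Truncated subtraction of bits is set difference: the current frame loses the neighbours
  of the best vertex in place, while a copy of the old bits is laid down above it.\<close>

definition split_loop :: com where
  "split_loop = While 13 (Do [Load 15 12, Store 24 15, Load 16 22, Sub 15 15 16, Store 12 15,
     Add 12 12 2, Add 24 24 2, Add 22 22 2, Sub 13 13 2])"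

text \<open>Register 13 is 0 after the loop, so storing it clears the bit of the best vertex in the
  copy. The copy joins the stack only for degree at least 2; otherwise it is left above the top and
  thereby discarded.\<close>

definition branch :: com where
  "branch = Do [Copy 12 7, Copy 24 4, Copy 13 26] ;; split_loop ;;
     Do [Store 21 13, Sub 15 8 20, Store 12 15, Sub 15 8 2, Store 24 15, Sub 15 20 2] ;;
     Ite 15 (Do [Add 4 4 3, Add 5 5 2]) (Do [])"

text \<open>An edgeless node with a positive bound settles the answer: the output becomes 0, and
  setting the frame count to 0 ends the search. A node with bound 0 is popped.\<close>

definition main_body :: com where
  "main_body = Do [Sub 7 4 3, Add 12 7 26, Load 8 12] ;;
     Ite 8 (scan ;; Ite 19 branch (Do [Const 0 0, Const 5 0])) (Do [Copy 4 7, Sub 5 5 2])"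

definition read_row :: com where
  "read_row = While 13 (Do [Read 15, Store 9 15, Add 9 9 2, Sub 13 13 2])"

text \<open>Register 9 runs on through all loops, so the matrix, the all-ones frame and its bound
  end up contiguous. The output is preset to 1.\<close>

definition read_input :: com where
  "read_input = Do [Read 26, Read 8, Const 0 1, Const 2 1, Const 6 2, Add 3 26 2, Const 9 32, Copy 11 26] ;;
     While 11 (Do [Copy 13 26] ;; read_row ;; Do [Sub 11 11 2]) ;;
     Do [Copy 13 26] ;; While 13 (Do [Store 9 2, Add 9 9 2, Sub 13 13 2]) ;;
     Do [Store 9 8, Add 4 9 2, Const 5 1]"

definition program :: com where
  "program = read_input ;; While 5 main_body"

section \<open>Correctness\<close>

lemma ht_degree_loop:
  assumes "r 13 = n" "r 12 = p" "r 9 = q" "r 2 = 1" "r 6 = 2" "32 \<le> p" "32 \<le> q"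
  shows "ht n degree_loop (r, m, xs) (\<lambda>(r', m', xs'). m' = m \<and> xs' = xs \<and>
    r' 17 = r 17 + (\<Sum>v<n. m (p + v) + m (q + v) + r 14 - 2) \<and> r' 9 = q + n \<and>
    (\<forall>i. i \<notin> {9, 12, 13, 15, 16, 17} \<longrightarrow> r' i = r i))"
  unfolding degree_loop_def
  by (rule ht_For[where I = "\<lambda>k (r', m', xs'). m' = m \<and> xs' = xs \<and> r' 13 = n - k \<and>
      r' 12 = p + k \<and> r' 9 = q + k \<and>
      r' 17 = r 17 + (\<Sum>v<k. m (p + v) + m (q + v) + r 14 - 2) \<and>
      (\<forall>i. i \<notin> {9, 12, 13, 15, 16, 17} \<longrightarrow> r' i = r i)"])
    (use assms in \<open>auto intro!: ht_Do simp: algebra_simps\<close>)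

text \<open>The degree as the scan sees it: a deleted vertex gets 0 through its own bit in the
  conjunction.\<close>

definition adeg :: "nat set set \<Rightarrow> nat set \<Rightarrow> nat \<Rightarrow> nat" where
  "adeg E A u = (if u \<in> A then card (nbrs E A u) else 0)"

lemma adeg_sum:
  assumes "A \<subseteq> {..<n}"
  shows "(\<Sum>v<n. of_bool (v \<in> A) + of_bool ({u, v} \<in> E) + of_bool (u \<in> A) - 2) = adeg E A u"
proof (cases "u \<in> A")
  case True
  have "(\<Sum>v<n. of_bool (v \<in> A) + of_bool ({u, v} \<in> E) + of_bool (u \<in> A) - 2 :: nat)
      = (\<Sum>v<n. of_bool (v \<in> nbrs E A u))"
    using True by (intro sum.cong) (auto simp: nbrs_def)
  also have "\<dots> = card (nbrs E A u)"
    using assms by (subst sum_of_bool_eq) (auto simp: nbrs_def intro!: arg_cong[where f = card])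
  finally show ?thesis using True by (simp add: adeg_def)
qed (auto simp: adeg_def intro!: sum.neutral)

lemma adeg_le:
  assumes "A \<subseteq> {..<n}"
  shows "adeg E A u \<le> n"
proof -
  have "card (nbrs E A u) \<le> card {..<n}"
    using assms by (intro card_mono) (auto simp: nbrs_def)
  then show ?thesis by (simp add: adeg_def)
qed

definition key :: "nat \<Rightarrow> nat \<Rightarrow> nat" where
  "key n d = (if d = 1 then d + n else d)"

definition matrix_at :: "nat \<Rightarrow> nat set set \<Rightarrow> (nat \<Rightarrow> nat) \<Rightarrow> bool" where
  "matrix_at n E m \<longleftrightarrow> (\<forall>u<n. \<forall>v<n. m (32 + u * n + v) = of_bool ({u, v} \<in> E))"

definition frame_at :: "nat \<Rightarrow> (nat \<Rightarrow> nat) \<Rightarrow> nat \<Rightarrow> nat set \<times> nat \<Rightarrow> bool" where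
  "frame_at n m p f \<longleftrightarrow> fst f \<subseteq> {..<n} \<and> (\<forall>v<n. m (p + v) = of_bool (v \<in> fst f)) \<and> m (p + n) = snd f"

text \<open>A zero in register 19 says that no vertex of positive degree has been met; registers 20
  to 22 are then meaningless.\<close>

definition best :: "nat \<Rightarrow> nat set set \<Rightarrow> nat set \<Rightarrow> nat \<Rightarrow> nat \<Rightarrow> (nat \<Rightarrow> nat) \<Rightarrow> bool" where
  "best n E A p k r \<longleftrightarrow> (\<forall>u<k. key n (adeg E A u) \<le> r 19) \<and>
     (r 19 \<noteq> 0 \<longrightarrow> (\<exists>b<k. r 19 = key n (adeg E A b) \<and> r 20 = adeg E A b \<and>
        r 21 = p + b + (n + 1) \<and> r 22 = 32 + b * n))"

lemma best_cong:
  assumes "best n E A p k r" "r' 19 = r 19" "r' 20 = r 20" "r' 21 = r 21" "r' 22 = r 22"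
  shows "best n E A p k r'"
  using assms unfolding best_def by simp

lemma best_keep:
  assumes "best n E A p k r" "key n (adeg E A k) \<le> r 19"
    "r' 19 = r 19" "r' 20 = r 20" "r' 21 = r 21" "r' 22 = r 22"
  shows "best n E A p (Suc k) r'"
  using assms unfolding best_def by (auto simp: less_Suc_eq)

lemma best_new:
  assumes "best n E A p k r" "r 19 < key n (adeg E A k)"
    "r' 19 = key n (adeg E A k)" "r' 20 = adeg E A k" "r' 21 = p + k + (n + 1)" "r' 22 = 32 + k * n"
  shows "best n E A p (Suc k) r'"
  using assms unfolding best_def by (force simp: less_Suc_eq)

lemma ht_update_best:
  assumes "r 26 = n" "r 2 = 1" "r 3 = n + 1" "r 6 = 2" "r 10 = p + k" "r 23 = 32 + k * n"
    "r 17 = adeg E A k" "best n E A p k r"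
  shows "ht n update_best (r, m, xs) (\<lambda>(r', m', xs'). m' = m \<and> xs' = xs \<and>
    best n E A p (Suc k) r' \<and> (\<forall>i. i \<notin> {15, 16, 18, 19, 20, 21, 22} \<longrightarrow> r' i = r i))"
proof -
  have tail: "ht n (Do [Sub 15 18 19] ;;
     Ite 15 (Do [Copy 19 18, Copy 20 17, Copy 22 23, Add 21 10 3]) (Do [])) (r', m, xs)
     (\<lambda>(r', m', xs'). m' = m \<and> xs' = xs \<and>
    best n E A p (Suc k) r' \<and> (\<forall>i. i \<notin> {15, 16, 18, 19, 20, 21, 22} \<longrightarrow> r' i = r i))"
    if "r' 18 = key n (adeg E A k)" "\<forall>i. i \<notin> {15, 16, 18} \<longrightarrow> r' i = r i" for r'
    apply (rule ht_Seq, rule ht_Do)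
    apply simp
    apply (rule ht_Ite)
    subgoal by simp
    subgoal using that assms by (intro ht_Do) (auto intro!: best_new[where r = r])
    subgoal using that assms by (intro ht_Do) (auto intro!: best_keep[where r = r])
    done
  show ?thesis
    unfolding update_best_def
    apply (rule ht_Seq, rule ht_Do)
    apply (simp add: assms)
    apply (rule ht_Seq, rule ht_Ite)
    subgoal by simp
    subgoal by (rule ht_Do, simp add: assms, rule tail[simplified]) (auto simp: key_def assms)
    subgoal by (rule ht_Do, simp add: assms, rule tail[simplified]) (auto simp: key_def assms)
    done
qed

lemma ht_scan_body:
  assumes "r 26 = n" "r 2 = 1" "r 3 = n + 1" "r 6 = 2" "r 7 = p" "32 \<le> p" "matrix_at n E m"
    "frame_at n m p (A, c)" "k < n" "r 10 = p + k" "r 9 = 32 + k * n" "best n E A p k r"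
  shows "ht n scan_body (r, m, xs) (\<lambda>(r', m', xs'). m' = m \<and> xs' = xs \<and> r' 10 = p + Suc k \<and>
    r' 9 = 32 + Suc k * n \<and> r' 11 = r 11 - 1 \<and> best n E A p (Suc k) r' \<and>
    (\<forall>i. i \<notin> {9..23} \<longrightarrow> r' i = r i))"
proof -
  have A: "A \<subseteq> {..<n}" using assms(8) by (simp add: frame_at_def)
  have m1: "m (p + v) = of_bool (v \<in> A)" if "v < n" for v
    using assms(8) that by (auto simp: frame_at_def)
  have m2: "m (32 + k * n + v) = of_bool ({k, v} \<in> E)" if "v < n" for v
    using assms(7) that \<open>k < n\<close> by (auto simp: matrix_at_def)
  have S: "(\<Sum>v<n. m (p + v) + m (32 + k * n + v) + m (p + k) - 2) = adeg E A k"
    unfolding adeg_sum[OF A, symmetric] using \<open>k < n\<close>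
    by (intro sum.cong) (simp_all add: m1 m2)
  show ?thesis
    unfolding scan_body_def
    apply (rule ht_Seq, rule ht_Do)
    apply (simp add: assms trans_le_add1)
    apply (rule ht_Seq)
    apply (rule ht_mono)
     apply (rule ht_degree_loop[where p = p and q = "32 + k * n"])
           apply (simp_all add: assms S)
    apply (clarify)
    apply (rule ht_Seq)
    apply (rule ht_mono)
     apply (rule ht_update_best[where p = p and k = k and E = E and A = A])
            apply (simp_all add: assms)
    subgoal using assms(12) by (simp add: best_def)
    apply clarify
    apply (rule ht_Do)
    apply (auto simp: assms intro: best_cong)
    done
qed

lemma ht_scan:
  assumes "r 26 = n" "r 2 = 1" "r 3 = n + 1" "r 6 = 2" "r 7 = p" "32 \<le> p" "matrix_at n E m"
    "frame_at n m p (A, c)"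
  shows "ht n scan (r, m, xs) (\<lambda>(r', m', xs'). m' = m \<and> xs' = xs \<and> best n E A p n r' \<and>
    (\<forall>i. i \<notin> {9..23} \<longrightarrow> r' i = r i))"
  unfolding scan_def
  apply (rule ht_Seq, rule ht_Do)
  apply (simp add: assms)
  apply (rule ht_For[where I = "\<lambda>k (r', m', xs'). m' = m \<and> xs' = xs \<and> r' 10 = p + k \<and>
    r' 9 = 32 + k * n \<and> r' 11 = n - k \<and> best n E A p k r' \<and> (\<forall>i. i \<notin> {9..23} \<longrightarrow> r' i = r i)"])
      apply (simp_all add: assms)
   apply (simp add: best_def)
  apply clarsimp
  apply (rule ht_mono)
   apply (rule ht_scan_body[where p = p and n = n and E = E and A = A and c = c])
              apply (simp_all add: assms)
  apply auto
  done

section \<open>Splitting a frame and the layout of the stack\<close>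

text \<open>The order \<open>w + n \<le> p\<close> and \<open>p + n \<le> q\<close> keeps row, frame
  and copy disjoint, so every cell is read before it is overwritten.\<close>

lemma ht_split_loop:
  assumes "r 13 = n" "r 12 = p" "r 24 = q" "r 22 = w" "r 2 = 1" "32 \<le> w" "w + n \<le> p" "p + n \<le> q"
  shows "ht n split_loop (r, m, xs) (\<lambda>(r', m', xs'). xs' = xs \<and>
    (\<forall>v<n. m' (p + v) = m (p + v) - m (w + v)) \<and> (\<forall>v<n. m' (q + v) = m (p + v)) \<and>
    (\<forall>a. a \<notin> {p..<p + n} \<union> {q..<q + n} \<longrightarrow> m' a = m a) \<and>
    r' 12 = p + n \<and> r' 24 = q + n \<and> r' 13 = 0 \<and>
    (\<forall>i. i \<notin> {12, 13, 15, 16, 22, 24} \<longrightarrow> r' i = r i))"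
  unfolding split_loop_def
  apply (rule ht_For[where I = "\<lambda>k (r', m', xs'). xs' = xs \<and>
    (\<forall>v<k. m' (p + v) = m (p + v) - m (w + v)) \<and> (\<forall>v<k. m' (q + v) = m (p + v)) \<and>
    (\<forall>a. a \<notin> {p..<p + k} \<union> {q..<q + k} \<longrightarrow> m' a = m a) \<and>
    r' 12 = p + k \<and> r' 24 = q + k \<and> r' 13 = n - k \<and> r' 22 = w + k \<and>
    (\<forall>i. i \<notin> {12, 13, 15, 16, 22, 24} \<longrightarrow> r' i = r i)"])
  subgoal by simp
  subgoal using assms by simp
  subgoal using assms by (auto intro!: ht_Do simp: less_Suc_eq)
  subgoal by auto
  subgoal by auto
  done

definition frame_base :: "nat \<Rightarrow> nat \<Rightarrow> nat" where
  "frame_base n j = 32 + n * n + j * (n + 1)"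

text \<open>The head of the list is the top of the stack, so its position is given by the number of
  frames below it.\<close>

fun stack_at :: "nat \<Rightarrow> (nat \<Rightarrow> nat) \<Rightarrow> (nat set \<times> nat) list \<Rightarrow> bool" where
  "stack_at n m [] = True"
| "stack_at n m (f # fs) = (frame_at n m (frame_base n (length fs)) f \<and> stack_at n m fs)"

lemma frame_base_Suc: "frame_base n (Suc j) = frame_base n j + (n + 1)"
  by (simp add: frame_base_def)

lemma frame_base_ge: "32 + n * n \<le> frame_base n j"
  by (simp add: frame_base_def)

lemma frame_at_cong:
  "frame_at n m p f \<Longrightarrow> (\<And>a. p \<le> a \<Longrightarrow> a < p + (n + 1) \<Longrightarrow> m' a = m a) \<Longrightarrow> frame_at n m' p f"
  by (auto simp: frame_at_def)

lemma stack_at_cong: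
  "stack_at n m fs \<Longrightarrow>
    (\<And>a. 32 + n * n \<le> a \<Longrightarrow> a < frame_base n (length fs) \<Longrightarrow> m' a = m a) \<Longrightarrow> stack_at n m' fs"
proof (induction fs)
  case (Cons f fs)
  have "frame_at n m' (frame_base n (length fs)) f"
  proof (rule frame_at_cong)
    show "frame_at n m (frame_base n (length fs)) f" using Cons.prems(1) by simp
    show "m' a = m a" if "frame_base n (length fs) \<le> a" "a < frame_base n (length fs) + (n + 1)" for a
      using that frame_base_ge[of n "length fs"] by (intro Cons.prems(2)) (auto simp: frame_base_Suc)
  qed
  moreover have "stack_at n m' fs"
  proof (rule Cons.IH)
    show "m' a = m a" if "32 + n * n \<le> a" "a < frame_base n (length fs)" for a
      using that by (intro Cons.prems(2)) (auto simp: frame_base_Suc)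
  qed (use Cons.prems(1) in simp)
  ultimately show ?case by simp
qed simp

lemma row_index_less: "u < n \<Longrightarrow> v < n \<Longrightarrow> u * n + v < n * (n::nat)"
proof -
  assume "u < n" "v < n"
  then have "Suc u * n \<le> n * n" by (intro mult_right_mono) auto
  then show ?thesis using \<open>v < n\<close> by simp
qed

lemma matrix_at_cong:
  "matrix_at n E m \<Longrightarrow> (\<And>a. a < 32 + n * n \<Longrightarrow> m' a = m a) \<Longrightarrow> matrix_at n E m'"
  unfolding matrix_at_def add.assoc by (metis add_less_cancel_left row_index_less)

section \<open>The invariant of the search\<close>

text \<open>\<open>j\<close> bounds the total weight of the pending nodes and is the potential of
  the loop. The second alternative is the state after a small cover has been found; in the first, an
  empty stack means that none exists.\<close>

definition search_inv :: "nat \<Rightarrow> nat set set \<Rightarrow> nat \<Rightarrow> nat \<Rightarrow> state \<Rightarrow> bool" where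
  "search_inv n E k j s \<longleftrightarrow> (case s of (r, m, xs) \<Rightarrow>
     r 26 = n \<and> r 2 = 1 \<and> r 3 = n + 1 \<and> r 6 = 2 \<and> matrix_at n E m \<and>
     ((\<exists>fs. r 0 = 1 \<and> r 5 = length fs \<and> r 4 = frame_base n (length fs) \<and> stack_at n m fs \<and>
         (sol E {..<n} k \<longleftrightarrow> (\<exists>f\<in>set fs. sol E (fst f) (snd f))) \<and>
         (\<Sum>f\<leftarrow>fs. weight E (fst f) (snd f)) \<le> real j) \<or>
      (r 0 = 0 \<and> r 5 = 0 \<and> sol E {..<n} k)))"

lemma best_zero:
  assumes "best n E A p n r" "r 19 = 0" "A \<subseteq> {..<n}" "v \<in> A"
  shows "nbrs E A v = {}"
proof -
  have "key n (adeg E A v) = 0" using assms by (auto simp: best_def)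
  then have "card (nbrs E A v) = 0" using assms(4) by (auto simp: key_def adeg_def split: if_splits)
  moreover have "finite (nbrs E A v)" 
    by (rule finite_subset[of _ "{..<n}"]) (use assms(3) in \<open>auto simp: nbrs_def\<close>)
  ultimately show ?thesis by simp
qed

lemma best_nonzero:
  assumes "best n E A p n r" "r 19 \<noteq> 0" "A \<subseteq> {..<n}"
  obtains v where "v \<in> A" "v < n" "r 20 = card (nbrs E A v)" "r 20 \<noteq> 0" "r 21 = p + v + (n + 1)"
    "r 22 = 32 + v * n"
    "r 20 \<noteq> 1 \<Longrightarrow> \<not> has_leaf E A" "r 20 \<noteq> 1 \<Longrightarrow> \<forall>u\<in>A. card (nbrs E A u) \<le> card (nbrs E A v)"
proof -
  obtain b where b: "b < n" "r 19 = key n (adeg E A b)" "r 20 = adeg E A b" "r 21 = p + b + (n + 1)"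
    "r 22 = 32 + b * n"
    using assms by (auto simp: best_def)
  have nz: "adeg E A b \<noteq> 0" using b(2) assms(2) by (auto simp: key_def split: if_splits)
  then have bA: "b \<in> A" by (auto simp: adeg_def split: if_splits)
  have mx: "key n (card (nbrs E A u)) \<le> key n (adeg E A b)" if "u \<in> A" for u
  proof -
    have "u < n" using assms(3) that by blast
    then have "key n (adeg E A u) \<le> r 19" using assms(1) unfolding best_def by blast
    moreover have "adeg E A u = card (nbrs E A u)" using that by (simp add: adeg_def)
    ultimately show ?thesis using b(2) by simp
  qed
  \<comment> \<open>The best key is then a degree, hence at most \<open>n\<close>, whereas a leaf
    would have key \<open>n + 1\<close>.\<close>
  have no_leaf: "card (nbrs E A u) \<noteq> 1" if "r 20 \<noteq> 1" "u \<in> A" for u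
  proof -
    have "key n (adeg E A b) \<le> n"
      using that(1) b(3) adeg_le[OF assms(3), of E b] by (simp add: key_def)
    then show ?thesis using mx[OF that(2)] by (auto simp: key_def)
  qed
  have le: "card (nbrs E A u) \<le> card (nbrs E A b)" if "r 20 \<noteq> 1" "u \<in> A" for u
  proof -
    have "key n (adeg E A b) = card (nbrs E A b)"
      using that(1) b(3) bA by (simp add: key_def adeg_def)
    then show ?thesis using mx[OF that(2)] no_leaf[OF that] by (simp add: key_def)
  qed
  show thesis
  proof (rule that[of b])
    show "r 20 = card (nbrs E A b)" using b(3) bA by (simp add: adeg_def)
    show "\<not> has_leaf E A" if "r 20 \<noteq> 1" using no_leaf[OF that] unfolding has_leaf_def by blast
  qed (use b nz bA le in auto)
qed

lemma ht_branch:
  assumes G: "simple_graph {..<n} E"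
    and r: "r 26 = n" "r 2 = 1" "r 3 = n + 1" "r 6 = 2" "r 0 = 1" "r 5 = Suc (length fs)"
      "r 4 = frame_base n (Suc (length fs))" "r 7 = frame_base n (length fs)" "r 8 = c"
    and m: "matrix_at n E m" "frame_at n m (frame_base n (length fs)) (A, c)" "stack_at n m fs"
    and c: "c > 0"
    and s: "sol E {..<n} k \<longleftrightarrow> sol E A c \<or> (\<exists>f\<in>set fs. sol E (fst f) (snd f))"
    and w: "weight E A c + (\<Sum>f\<leftarrow>fs. weight E (fst f) (snd f)) \<le> real j"
    and b: "best n E A (frame_base n (length fs)) n r" "r 19 \<noteq> 0"
  shows "ht n branch (r, m, xs) (search_inv n E k (j - 1))"
proof -
  define p where "p = frame_base n (length fs)"
  have A: "A \<subseteq> {..<n}" "finite A" using m(2) finite_subset by (auto simp: frame_at_def)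
  obtain v where v: "v \<in> A" "v < n" "r 20 = card (nbrs E A v)" "r 20 \<noteq> 0" "r 21 = p + v + (n + 1)"
    "r 22 = 32 + v * n"
    "r 20 \<noteq> 1 \<Longrightarrow> \<not> has_leaf E A" "r 20 \<noteq> 1 \<Longrightarrow> \<forall>u\<in>A. card (nbrs E A u) \<le> card (nbrs E A v)"
    using best_nonzero[OF b A(1)] unfolding p_def by metis
  define d where "d = card (nbrs E A v)"
  have p: "32 + n * n \<le> p" "32 \<le> p" using frame_base_ge[of n "length fs"] by (auto simp: p_def)
  have pp: "31 \<le> p + v + n" "32 \<le> p + n" "31 \<le> p + n + n" using p(2) by auto
  \<comment> \<open>The row of \<open>v\<close> ends below the stack, as the split loop
    requires.\<close>
  have row: "32 + v * n + n \<le> p"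
  proof -
    have "Suc v * n \<le> n * n" using v(2) by (intro mult_right_mono) auto
    then show ?thesis using p(1) by simp
  qed
  have mp: "m (p + u) = of_bool (u \<in> A)" "m (32 + v * n + u) = of_bool ({v, u} \<in> E)" if "u < n" for u
    using m that v(2) by (auto simp: frame_at_def matrix_at_def p_def)
  \<comment> \<open>Handles the last conditional for any memory that holds both child frames; the
    preceding code is executed symbolically afterwards.\<close>
  have final: "ht n (Ite 15 (Do [Add 4 4 3, Add 5 5 2]) (Do [])) (r', m', xs) (search_inv n E k (j - 1))"
    if r': "r' 15 = d - 1" "\<forall>i. i \<notin> {12, 13, 15, 16, 22, 24} \<longrightarrow> r' i = r i"
      and m': "\<forall>u<n. m' (p + u) = of_bool (u \<in> A - nbrs E A v)" "m' (p + n) = c - d"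
        "\<forall>u<n. m' (p + (n + 1) + u) = of_bool (u \<in> A - {v})" "m' (p + (n + 1) + n) = c - 1"
        "\<forall>a<p. m' a = m a" for r' m'
  proof -
    have M: "matrix_at n E m'" using m'(5) p by (intro matrix_at_cong[OF m(1)]) auto
    have S: "stack_at n m' fs" using m'(5) by (intro stack_at_cong[OF m(3)]) (auto simp: p_def)
    have F1: "frame_at n m' p (A - nbrs E A v, c - d)"
      using m' A by (auto simp: frame_at_def)
    have F2: "frame_at n m' (frame_base n (Suc (length fs))) (A - {v}, c - 1)"
      using m' A by (auto simp: frame_at_def frame_base_Suc p_def)
    show ?thesis
    proof (rule ht_Ite)
      assume "fst (r', m', xs) 15 \<noteq> 0"
      then have d2: "d \<ge> 2" using r'(1) by simp
      then have n1: "r 20 \<noteq> 1" using v(3) by (simp add: d_def)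
      have "1 + weight E (A - {v}) (c - 1) + weight E (A - nbrs E A v) (c - d) \<le> weight E A c"
        unfolding d_def using v(7)[OF n1] v(8)[OF n1] d2 c
        by (intro weight_branch[OF G A(2) v(1)]) (auto simp: d_def)
      moreover have "sol E A c \<longleftrightarrow> sol E (A - {v}) (c - 1) \<or> sol E (A - nbrs E A v) (c - d)"
        unfolding d_def by (rule sol_branch[OF G A(2) v(1)])
      ultimately show "ht n (Do [Add 4 4 3, Add 5 5 2]) (r', m', xs) (search_inv n E k (j - 1))"
        using r r' M S F1 F2 s w weight_ge_1[of E A c]
        apply (intro ht_Do)
        apply (simp add: search_inv_def frame_base_Suc)
        apply (rule exI[of _ "(A - {v}, c - 1) # (A - nbrs E A v, c - d) # fs"])
        apply (simp add: frame_base_Suc p_def)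
        done
    next
      assume "fst (r', m', xs) 15 = 0"
      then have d1: "d = 1" using r'(1) v(3,4) by (simp add: d_def)
      have "1 + weight E (A - nbrs E A v) (c - 1) \<le> weight E A c"
        using d1 v(1) c by (intro weight_leaf) (auto simp: has_leaf_def d_def)
      moreover have "sol E A c \<longleftrightarrow> sol E (A - nbrs E A v) (c - 1)"
        using d1 by (intro sol_leaf[OF G A(2) v(1)]) (simp add: d_def)
      ultimately show "ht n (Do []) (r', m', xs) (search_inv n E k (j - 1))"
        using r r' M S F1 s w weight_ge_1[of E A c] d1
        apply (intro ht_Do)
        apply (simp add: search_inv_def frame_base_Suc)
        \<comment> \<open>The frame for \<open>A - {v}\<close> was written too, but lies above the
          top.\<close>
        apply (rule exI[of _ "(A - nbrs E A v, c - d) # fs"])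
        apply (simp add: frame_base_Suc p_def)
        done
    qed simp
  qed
  show ?thesis
    unfolding branch_def
    apply (rule ht_Seq, rule ht_Do)
    apply (simp add: r frame_base_Suc p_def[symmetric])
    apply (rule ht_Seq)
    apply (rule ht_mono)
     apply (rule ht_split_loop[where p = p and q = "p + (n + 1)" and w = "32 + v * n"])
            apply (simp_all add: r v row)
    apply (clarify)
    apply (rule ht_Seq, rule ht_Do)
    apply (simp add: r v pp)
    apply (rule final[unfolded One_nat_def])
    subgoal by (simp add: d_def)
    subgoal by simp
    subgoal using v(2) by (auto simp: mp nbrs_def)
    subgoal by (simp add: d_def)
    subgoal using v(2) by (auto simp: mp)
    subgoal by simp
    subgoal by simp
    done
qed

text \<open>Each round expands one node, and its weight exceeds that of its children by at least 1.
  As a pending node weighs at least 1, \<open>j\<close> cannot be 0.\<close>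

lemma ht_main_body:
  assumes G: "simple_graph {..<n} E" and I: "search_inv n E k j s" and nz: "fst s 5 \<noteq> 0"
  shows "j \<noteq> 0 \<and> ht n main_body s (search_inv n E k (j - 1))"
proof -
  obtain r m xs where s: "s = (r, m, xs)" by (cases s)
  obtain fs' where *: "r 26 = n" "r 2 = 1" "r 3 = n + 1" "r 6 = 2" "matrix_at n E m"
    "r 0 = 1" "r 5 = length fs'" "r 4 = frame_base n (length fs')" "stack_at n m fs'"
    "sol E {..<n} k \<longleftrightarrow> (\<exists>f\<in>set fs'. sol E (fst f) (snd f))"
    "(\<Sum>f\<leftarrow>fs'. weight E (fst f) (snd f)) \<le> real j"
    using I nz unfolding search_inv_def s by auto
  obtain A c fs where fs: "fs' = (A, c) # fs" using nz *(7) s by (cases fs') auto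
  let ?p = "frame_base n (length fs)"
  have F: "frame_at n m ?p (A, c)" and A: "A \<subseteq> {..<n}" and mc: "m (?p + n) = c"
    using *(9) by (auto simp: fs frame_at_def)
  have p: "32 \<le> ?p" using frame_base_ge[of n "length fs"] by simp
  have wf: "0 \<le> (\<Sum>f\<leftarrow>fs. weight E (fst f) (snd f))"
    by (intro sum_list_nonneg) (auto intro: order.trans[OF _ weight_ge_1])
  have W: "weight E A c + (\<Sum>f\<leftarrow>fs. weight E (fst f) (snd f)) \<le> real j" using *(11) fs by simp
  then have j: "j \<noteq> 0" using wf weight_ge_1[of E A c] by auto
  have "ht n main_body (r, m, xs) (search_inv n E k (j - 1))"
    unfolding main_body_def
    apply (rule ht_Seq, rule ht_Do)
    apply (simp add: * fs frame_base_Suc mc trans_le_add1[OF p])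
    apply (rule ht_Ite)
    subgoal by simp
    subgoal
      apply (rule ht_Seq)
      apply (rule ht_mono)
       apply (rule ht_scan[where p = ?p and E = E and A = A and c = c])
              apply (simp_all add: * p F)
      apply clarify
      apply (rule ht_Ite)
      subgoal by simp
      subgoal
        by (rule ht_branch[OF G, where A = A and c = c and fs = fs, unfolded One_nat_def])
          (use * W F in \<open>auto simp: fs\<close>)
      \<comment> \<open>No positive degree was found, so the empty set is a cover with fewer than
        \<open>c\<close> vertices.\<close>
      subgoal for a
        using * sol_edgeless[OF G, of A c] best_zero[of n E A ?p a]
        by (intro ht_Do) (auto simp: search_inv_def fs A)
      done
    \<comment> \<open>The bound is 0: the node has no solution, and dropping it releases weight
      1.\<close>
    subgoal
      using * W weight_ge_1[of E A c]
      by (intro ht_Do) (auto simp: search_inv_def fs sol_def frame_base_Suc intro!: exI[of _ fs])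
    done
  then show ?thesis using j s by simp
qed

section \<open>Reading the input\<close>

lemma nth_concat_rows:
  "(\<And>ys. ys \<in> set yss \<Longrightarrow> length ys = n) \<Longrightarrow> u < length yss \<Longrightarrow> v < n \<Longrightarrow>
    concat yss ! (u * n + v) = yss ! u ! v"
proof (induction yss arbitrary: u)
  case (Cons ys yss)
  then show ?case by (cases u) (auto simp: nth_append)
qed simp

lemma ht_read_row:
  assumes "r 13 = n" "r 9 = 32 + q" "r 2 = 1" "q + n \<le> length L" "\<forall>i<q. m (32 + i) = L ! i"
  shows "ht n read_row (r, m, drop q L) (\<lambda>(r', m', xs'). r' 9 = 32 + (q + n) \<and>
    xs' = drop (q + n) L \<and> (\<forall>i<q + n. m' (32 + i) = L ! i) \<and>
    (\<forall>i. i \<notin> {9, 13, 15} \<longrightarrow> r' i = r i))"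
  unfolding read_row_def
  apply (rule ht_For[where I = "\<lambda>k (r', m', xs'). r' 9 = 32 + (q + k) \<and> r' 13 = n - k \<and>
    xs' = drop (q + k) L \<and> (\<forall>i<q + k. m' (32 + i) = L ! i) \<and>
    (\<forall>i. i \<notin> {9, 13, 15} \<longrightarrow> r' i = r i)"])
  subgoal by simp
  subgoal using assms by simp
  subgoal for k s
    using assms Cons_nth_drop_Suc[of "q + k" L]
    by (cases s) (auto intro!: ht_Do simp: less_Suc_eq drop_Suc tl_drop split: list.splits)
  subgoal by auto
  subgoal by auto
  done

lemma ht_read_input:
  assumes w: "weight E {..<n} k \<le> real j"
  shows "ht n read_input ((\<lambda>_. 0), (\<lambda>_. 0), encode n E k) (search_inv n E k j)"
proof -
  define rows where "rows = map (\<lambda>u. map (\<lambda>v. if {u, v} \<in> E then 1 else 0 :: nat) [0..<n]) [0..<n]"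
  define L where "L = concat rows"
  have len: "length L = n * n"
    by (simp add: L_def rows_def length_concat comp_def sum_list_triv)
  have L: "L ! (u * n + v) = of_bool ({u, v} \<in> E)" if "u < n" "v < n" for u v
    using that unfolding L_def by (subst nth_concat_rows[where n = n]) (auto simp: rows_def)
  have enc: "encode n E k = n # k # drop 0 L" by (simp add: encode_def L_def rows_def)
  have fin: "ht n (Do [Copy 13 26] ;; While 13 (Do [Store 9 2, Add 9 9 2, Sub 13 13 2]) ;;
     Do [Store 9 8, Add 4 9 2, Const 5 1]) (r, m, xs) (search_inv n E k j)"
    if r: "r 26 = n" "r 8 = k" "r 0 = 1" "r 2 = 1" "r 6 = 2" "r 3 = n + 1" "r 9 = 32 + n * n"
      and m: "\<forall>i<n * n. m (32 + i) = L ! i" for r m xs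
  proof -
    have "matrix_at n E m"
      unfolding matrix_at_def add.assoc using m L row_index_less by simp
    note M = matrix_at_cong[OF this]
    show ?thesis
      apply (rule ht_Seq, rule ht_Do)
      apply simp
      apply (rule ht_Seq)
      apply (rule ht_For[where I = "\<lambda>l (r', m', xs'). r' 9 = 32 + n * n + l \<and> r' 13 = n - l \<and>
          (\<forall>v<l. m' (32 + n * n + v) = 1) \<and> (\<forall>a<32 + n * n. m' a = m a) \<and>
          (\<forall>i. i \<notin> {9, 13} \<longrightarrow> r' i = r i)"])
      subgoal by simp
      subgoal using r by simp
      subgoal using r by (auto intro!: ht_Do simp: less_Suc_eq)
      subgoal by auto
      subgoal premises prems for s
      proof -
        obtain r' m' xs' where s: "s = (r', m', xs')" by (cases s)
        have p: "r' 9 = 32 + n * n + n" "\<forall>v<n. m' (32 + n * n + v) = 1" "\<forall>a<32 + n * n. m' a = m a"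
          "r' 26 = n" "r' 8 = k" "r' 0 = 1" "r' 2 = 1" "r' 6 = 2" "r' 3 = n + 1"
          using prems r by (simp_all add: s)
        have "matrix_at n E (m'(32 + n * n + n := k))" by (rule M) (use p(3) in simp)
        moreover have "frame_at n (m'(32 + n * n + n := k)) (frame_base n 0) ({..<n}, k)"
          using p(2) by (simp add: frame_at_def frame_base_def)
        ultimately show ?thesis
          unfolding s using w
          apply (intro ht_Do)
          apply (simp add: search_inv_def p)
          \<comment> \<open>The root of the search: all vertices, with strict bound
            \<open>k\<close>.\<close>
          apply (rule exI[of _ "[({..<n}, k)]"])
          apply (simp add: frame_base_def)
          done
      qed
      done
  qed
  show ?thesis
    unfolding read_input_def enc
    apply (rule ht_Seq, rule ht_Do)
    apply simp
    apply (rule ht_Seq)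
    apply (rule ht_For[where I = "\<lambda>u (r, m, xs). r 26 = n \<and> r 8 = k \<and> r 0 = 1 \<and> r 2 = 1 \<and> r 6 = 2 \<and>
        r 3 = n + 1 \<and> r 9 = 32 + u * n \<and> r 11 = n - u \<and> xs = drop (u * n) L \<and>
        (\<forall>i<u * n. m (32 + i) = L ! i)"])
    subgoal by simp
    subgoal by simp
    subgoal premises prems for u s
    proof -
      obtain r m xs where s: "s = (r, m, xs)" by (cases s)
      have "Suc u * n \<le> n * n" using prems(1) by (intro mult_right_mono) auto
      then have le: "u * n + n \<le> length L" using len by simp
      show ?thesis
        using prems le unfolding s
        apply (intro conjI)
         apply simp
        apply (rule ht_Seq, rule ht_Do)
        apply simp
        apply (rule ht_Seq)
        apply (rule ht_mono)
         apply (rule ht_read_row[where q = "u * n" and L = L])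
             apply simp_all
        apply clarify
        apply (rule ht_Do)
        apply (simp add: add.commute)
        done
    qed
    subgoal by auto
    subgoal for s by (cases s) (use fin in auto)
    done
qed

section \<open>Running time and the final bound\<close>

text \<open>The additional 1 pays for the final test of the search loop. Since \<open>n\<close> is
  positive, the lower-order terms are absorbed by the square.\<close>

lemma cost_read_input: "n \<ge> 1 \<Longrightarrow> cost n read_input + 1 \<le> 100 * (n * n)"
proof -
  assume "n \<ge> 1"
  then have "n \<le> n * n" "1 \<le> n * n" by auto
  moreover have "cost n read_input + 1 = 6 * (n * n) + 10 * n + 15"
    unfolding read_input_def read_row_def by (simp add: algebra_simps)
  ultimately show ?thesis by linarith
qed

lemma cost_main_body: "n \<ge> 1 \<Longrightarrow> cost n main_body + 2 \<le> 100 * (n * n)"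
proof -
  assume "n \<ge> 1"
  then have "n \<le> n * n" "1 \<le> n * n" by auto
  moreover have "cost n main_body + 2 = 11 * (n * n) + 36 * n + 32"
    unfolding main_body_def scan_def scan_body_def degree_loop_def update_best_def branch_def
      split_loop_def
    by (simp add: algebra_simps)
  ultimately show ?thesis by linarith
qed

theorem theorem9:
  shows "\<exists>(P :: instr list) (C :: real). \<forall>(n :: nat) (E :: nat set set).
    simple_graph {..<n} E \<longrightarrow>
    (\<exists>t :: nat.
       computes_within P (encode n E (vc_plus {..<n} E)) t
         (if well_covered {..<n} E then 1 else 0) \<and>
       (n \<ge> 1 \<longrightarrow> real t \<le> C * 1.4656 ^ vc_plus {..<n} E * real n ^ 2))"
proof (intro exI[of _ "compile 0 program"] exI[of _ "500 :: real"] allI impI)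
  fix n :: nat and E :: "nat set set"
  assume G: "simple_graph {..<n} E"
  define k where "k = vc_plus {..<n} E"
  define w where "w = weight E {..<n} k"
  \<comment> \<open>The root weight rounded up, as the loop rule counts rounds by a natural
    number.\<close>
  define j where "j = nat \<lceil>w\<rceil>"
  let ?s = "((\<lambda>_. 0), (\<lambda>_. 0), encode n E k) :: state"
  have w1: "1 \<le> w" by (simp add: w_def weight_ge_1)
  have j: "w \<le> real j" "real j \<le> w + 1" using w1 unfolding j_def by linarith+
  obtain t1 s1 where s1: "big read_input ?s t1 s1" "t1 \<le> cost n read_input" "search_inv n E k j s1"
    using ht_read_input[of E n k j] j(1) unfolding ht_def w_def by blast
  obtain t2 s2 l where s2: "big (While 5 main_body) s1 t2 s2" "t2 \<le> j * (cost n main_body + 2) + 1"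
    "search_inv n E k l s2" "fst s2 5 = 0"
    using big_While[where I = "search_inv n E k" and i = 5 and n = n and c = main_body, OF _ _ s1(3)]
      ht_main_body[OF G] by force
  have big: "big program ?s (t1 + t2) s2"
    unfolding program_def using s1(1) s2(1) by (rule big.Seq)
  have "placed (compile 0 program) 0 (compile 0 program)" by (simp add: placed_def)
  note * = big_steps[OF big this]
  have start: "initial (encode n E k) = conc 0 ?s" by (auto simp: conc_def initial_def)
  from * have steps: "(step (compile 0 program) ^^ (t1 + t2)) (initial (encode n E k)) = conc (csize program) s2"
    unfolding start by simp
  \<comment> \<open>With register 5 at 0, either the stack ran empty without a solution or one was
    found; the output register tells which.\<close>
  have out: "fst s2 0 = (if well_covered {..<n} E then 1 else 0)"
    using s2(3,4) unfolding well_covered_iff_not_sol[OF G] k_def[symmetric] search_inv_def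
    by (auto split: prod.splits)
  have "computes_within (compile 0 program) (encode n E k) (t1 + t2) (if well_covered {..<n} E then 1 else 0)"
    unfolding computes_within_def Let_def steps using out by (simp add: halted_def conc_def)
  moreover have "real (t1 + t2) \<le> 500 * 1.4656 ^ k * real n ^ 2" if n: "n \<ge> 1"
  proof -
    have "t1 + t2 \<le> (cost n read_input + 1) + j * (cost n main_body + 2)"
      using s1(2) s2(2) by simp
    also have "\<dots> \<le> 100 * (n * n) + j * (100 * (n * n))"
      using cost_read_input[OF n] cost_main_body[OF n] by (intro add_mono mult_left_mono) auto
    finally have "t1 + t2 \<le> (1 + j) * (100 * (n * n))" by simp
    then have "real (t1 + t2) \<le> real ((1 + j) * (100 * (n * n)))" using of_nat_mono by blast
    also have "\<dots> = (1 + real j) * (100 * real n ^ 2)" by (simp add: power2_eq_square distrib_right)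
    \<comment> \<open>Rounding adds at most 1, so \<open>1 + j\<close> is at most
      \<open>tree_bound k + 2\<close>, that is \<open>4 * phi ^ k\<close>.\<close>
    also have "\<dots> \<le> (5 * phi ^ k) * (100 * real n ^ 2)"
      using j(2) weight_le[of E "{..<n}" k] phi_power_ge_1[of k]
      by (intro mult_right_mono) (auto simp: w_def tree_bound_def)
    finally show ?thesis by (simp add: phi_def)
  qed
  ultimately show "\<exists>t. computes_within (compile 0 program) (encode n E (vc_plus {..<n} E)) t
         (if well_covered {..<n} E then 1 else 0) \<and>
       (n \<ge> 1 \<longrightarrow> real t \<le> 500 * 1.4656 ^ vc_plus {..<n} E * real n ^ 2)"
    unfolding k_def by blast
qed

end
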